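(* Let $g\ge1$, let $t=(t_1,\dots,t_g)\in[-2,2]^g$ and let $m\in\mathrm{USp}_{2g}$ be conjugate to $k(t_1,\dots,t_g)$. If $0\le n\le g$, then $$\mathrm{Trace}(\wedge^n m)=\sum_{j=0}^{\lfloor n/2\rfloor}\binom{g+2j-n}{j}\,s_{n-2j}(t).$$
   Context: $\mathrm{USp}_{2g}=\{m\in \mathrm{GL}_{2g}(\mathbb{C}) : {}^t m J m=J,\ {}^t m\,\bar m=I_{2g}\}$ with $J=\begin{pmatrix}0&I_g\\-I_g&0\end{pmatrix}$. $k(t_1,\dots,t_g)=\mathrm{diag}(e^{i\theta_1},\dots,e^{i\theta_g},e^{-i\theta_1},\dots,e^{-i\theta_g})$ with $\theta_j=\arccos(t_j/2)$. $\wedge^n m$ is the $n$-th exterior power of $m$ acting on $\wedge^n\mathbb{C}^{2g}$. $s_n(t)$ is the elementary symmetric polynomial of degree $n$ in $t_1,\dots,t_g$, with $s_0(t)=1$. *)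

theory Defs
  imports Complex_Main "Jordan_Normal_Form.Matrix" "HOL-Combinatorics.Permutations"
    "HOL-Library.Function_Algebras"
begin

section \<open>The compact symplectic group\<close>

definition symp_J :: "nat \<Rightarrow> complex mat" where
  "symp_J g = four_block_mat (0\<^sub>m g g) (1\<^sub>m g) (- 1\<^sub>m g) (0\<^sub>m g g)"

definition USp :: "nat \<Rightarrow> complex mat set" where
  "USp g = {m \<in> carrier_mat (2 * g) (2 * g). invertible_mat m \<and>
     transpose_mat m * symp_J g * m = symp_J g \<and>
     transpose_mat m * map_mat cnj m = 1\<^sub>m (2 * g)}"

definition kmat :: "real vec \<Rightarrow> complex mat" where
  "kmat t = (let g = dim_vec t; \<theta> = (\<lambda>j. arccos (t $ j / 2)) in
     mat_diag (2 * g) (\<lambda>i. if i < g then exp (\<i> * complex_of_real (\<theta> i))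
                          else exp (- \<i> * complex_of_real (\<theta> (i - g)))))"

definition USp_conjugate :: "nat \<Rightarrow> complex mat \<Rightarrow> complex mat \<Rightarrow> bool" where
  "USp_conjugate g a b \<longleftrightarrow> (\<exists>u \<in> USp g. \<exists>v. similar_mat_wit a b u v)"

definition elem_sym :: "nat \<Rightarrow> real vec \<Rightarrow> real" where
  "elem_sym n t = (\<Sum>A | A \<subseteq> {..<dim_vec t} \<and> card A = n. \<Prod>i\<in>A. t $ i)"


section \<open>Trace of an endomorphism of a finite-dimensional subspace\<close>

context vector_space
begin

text \<open>The chosen basis does not matter: see \<open>trace_basis_independent\<close>.\<close>

definition trace_on :: "'b set \<Rightarrow> ('b \<Rightarrow> 'b) \<Rightarrow> 'a" where
  "trace_on V f = (let B = (SOME B. independent B \<and> span B = V) in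
     \<Sum>b\<in>B. representation B (f b) b)"

lemma trace_basis_independent:
  assumes B: "independent B" "span B = V" "finite B"
    and C: "independent C" "span C = V" "finite C"
    and add: "\<And>x y. x \<in> V \<Longrightarrow> y \<in> V \<Longrightarrow> f (x + y) = f x + f y"
    and scale: "\<And>a x. x \<in> V \<Longrightarrow> f (scale a x) = scale a (f x)"
    and maps: "\<And>x. x \<in> V \<Longrightarrow> f x \<in> V"
  shows "(\<Sum>b\<in>B. representation B (f b) b) = (\<Sum>c\<in>C. representation C (f c) c)"
proof -
  let ?RB = "representation B" and ?RC = "representation C"
  have BV: "b \<in> V" if "b \<in> B" for b using that B span_base by blast
  have CV: "c \<in> V" if "c \<in> C" for c using that C span_base by blast
  have V0: "0 \<in> V" using B span_zero by blast
  have f0: "f 0 = 0" using scale[OF V0, of 0] by simp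
  have Vsum: "(\<Sum>i\<in>I. scale (a i) (x i)) \<in> V" if "\<And>i. i \<in> I \<Longrightarrow> x i \<in> V"
    for I :: "'b set" and a x
    using that B(2) by (metis (no_types, lifting) span_scale span_sum)
  have fsum: "f (\<Sum>i\<in>I. scale (a i) (x i)) = (\<Sum>i\<in>I. scale (a i) (f (x i)))"
    if "finite I" "\<And>i. i \<in> I \<Longrightarrow> x i \<in> V" for I :: "'b set" and a x
    using that
  proof (induction I rule: finite_induct)
    case (insert i I)
    have "scale (a i) (x i) \<in> V" using insert.prems B(2) span_scale by blast
    then show ?case using insert Vsum[of I x a] by (simp add: add scale)
  qed (simp add: f0)
  have repB_sum: "?RB (\<Sum>i\<in>I. scale (a i) (x i)) b = (\<Sum>i\<in>I. a i * ?RB (x i) b)"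
    if "\<And>i. i \<in> I \<Longrightarrow> x i \<in> V" for I :: "'b set" and a x b
    using that B by (subst representation_sum) (auto simp: span_scale representation_scale)
  have expB: "(\<Sum>b\<in>B. scale (?RB v b) b) = v" if "v \<in> V" for v
    using that B by (intro sum_representation_eq) auto
  have expC: "(\<Sum>c\<in>C. scale (?RC v c) c) = v" if "v \<in> V" for v
    using that C by (intro sum_representation_eq) auto
  have repC_sum: "?RC (\<Sum>i\<in>I. scale (a i) (x i)) b = (\<Sum>i\<in>I. a i * ?RC (x i) b)"
    if "\<And>i. i \<in> I \<Longrightarrow> x i \<in> V" for I :: "'b set" and a x b
    using that C by (subst representation_sum) (auto simp: span_scale representation_scale)
  have l: "?RB (f b) b = (\<Sum>c\<in>C. ?RC b c * ?RB (f c) b)" if b: "b \<in> B" for b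
    using arg_cong[OF fsum[of C "\<lambda>c. c" "?RC b"], of "\<lambda>v. ?RB v b"]
      repB_sum[of C f "?RC b" b] expC[OF BV[OF b]] CV maps C(3) by simp
  have r: "?RC (f c) c = (\<Sum>b\<in>B. ?RB (f c) b * ?RC b c)" if c: "c \<in> C" for c
    using repC_sum[of B "\<lambda>b. b" "?RB (f c)" c] expB[OF maps[OF CV[OF c]]] BV by simp
  show ?thesis by (simp add: l r) (subst sum.swap, simp add: mult.commute)
qed

end


section \<open>Exterior powers of complex coordinate space\<close>

text \<open>
  A tensor in the \<open>n\<close>-fold tensor power of \<open>d\<close>-dimensional coordinate space is given by its
  coordinates, indexed by the lists of length \<open>n\<close> with entries below \<open>d\<close>; outside these lists it
  is \<open>0\<close>. As the characteristic is zero, the exterior power is realised as the space of alternating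
  tensors, on which a matrix acts as the restriction of its \<open>n\<close>-fold tensor power. Here
  \<open>v\<^sub>1 \<and> \<dots> \<and> v\<^sub>n\<close> is the antisymmetrisation of \<open>v\<^sub>1 \<otimes> \<dots> \<otimes> v\<^sub>n\<close>; such elements span
  (\<open>span_wedge\<close>), and the action sends \<open>v\<^sub>1 \<and> \<dots> \<and> v\<^sub>n\<close> to \<open>m v\<^sub>1 \<and> \<dots> \<and> m v\<^sub>n\<close>
  (\<open>ext_map_wedge\<close>).
\<close>

type_synonym tensor = "nat list \<Rightarrow> complex"

definition tensor_scale :: "complex \<Rightarrow> tensor \<Rightarrow> tensor" where
  "tensor_scale c T = (\<lambda>xs. c * T xs)"

interpretation tensor: vector_space tensor_scale
  by unfold_locales (auto simp: tensor_scale_def fun_eq_iff algebra_simps)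

definition tensor_index :: "nat \<Rightarrow> nat \<Rightarrow> nat list set" where
  "tensor_index d n = {xs. set xs \<subseteq> {..<d} \<and> length xs = n}"

definition ext_space :: "nat \<Rightarrow> nat \<Rightarrow> tensor set" where
  "ext_space d n = {T. (\<forall>xs. xs \<notin> tensor_index d n \<longrightarrow> T xs = 0) \<and>
     (\<forall>\<sigma>. \<sigma> permutes {..<n} \<longrightarrow>
       (\<forall>xs \<in> tensor_index d n. T (permute_list \<sigma> xs) = of_int (sign \<sigma>) * T xs))}"

definition ext_map :: "nat \<Rightarrow> complex mat \<Rightarrow> tensor \<Rightarrow> tensor" where
  "ext_map n m T = (\<lambda>xs. if xs \<in> tensor_index (dim_row m) n
     then \<Sum>ys \<in> tensor_index (dim_col m) n. (\<Prod>i<n. m $$ (xs ! i, ys ! i)) * T ys else 0)"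

definition wedge :: "nat \<Rightarrow> complex vec list \<Rightarrow> tensor" where
  "wedge d vs = (\<lambda>xs. if xs \<in> tensor_index d (length vs)
     then \<Sum>\<sigma> | \<sigma> permutes {..<length vs}.
       of_int (sign \<sigma>) * (\<Prod>i<length vs. vs ! \<sigma> i $ (xs ! i)) else 0)"

lemma finite_tensor_index [simp]: "finite (tensor_index d n)"
  unfolding tensor_index_def by (rule finite_lists_length_eq) simp

lemma permute_list_tensor_index:
  "\<sigma> permutes {..<n} \<Longrightarrow> xs \<in> tensor_index d n \<Longrightarrow> permute_list \<sigma> xs \<in> tensor_index d n"
  by (auto simp: tensor_index_def)

lemma wedge_in_ext_space: "wedge d vs \<in> ext_space d (length vs)"
proof -
  let ?n = "length vs"
  have "wedge d vs (permute_list \<tau> xs) = of_int (sign \<tau>) * wedge d vs xs"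
    if \<tau>: "\<tau> permutes {..<?n}" and xs: "xs \<in> tensor_index d ?n" for \<tau> xs
  proof -
    have len: "length xs = ?n" using xs by (simp add: tensor_index_def)
    have inv: "Hilbert_Choice.inv \<tau> permutes {..<?n}" using \<tau> by (rule permutes_inv)
    have pr: "(\<Prod>i<?n. vs ! \<sigma> i $ (permute_list \<tau> xs ! i)) =
        (\<Prod>i<?n. vs ! (\<sigma> \<circ> Hilbert_Choice.inv \<tau>) i $ (xs ! i))" for \<sigma>
    proof -
      have "(\<Prod>i<?n. vs ! \<sigma> i $ (permute_list \<tau> xs ! i)) = (\<Prod>i<?n. vs ! \<sigma> i $ (xs ! \<tau> i))"
        using \<tau> len by (intro prod.cong) (auto simp: permute_list_nth)
      also have "\<dots> = (\<Prod>i<?n. vs ! \<sigma> (Hilbert_Choice.inv \<tau> i) $ (xs ! \<tau> (Hilbert_Choice.inv \<tau> i)))"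
        using prod.permute[OF inv, of "\<lambda>i. vs ! \<sigma> i $ (xs ! \<tau> i)"] by (simp add: o_def)
      finally show ?thesis using \<tau> by (simp add: permutes_inverses)
    qed
    have sg: "sign \<sigma> = sign \<tau> * sign (\<sigma> \<circ> Hilbert_Choice.inv \<tau>)" if "\<sigma> permutes {..<?n}" for \<sigma>
    proof -
      have "permutation \<sigma>" "permutation \<tau>" "permutation (Hilbert_Choice.inv \<tau>)"
        using that \<tau> inv permutation_permutes by blast+
      then have "sign (\<sigma> \<circ> Hilbert_Choice.inv \<tau>) = sign \<sigma> * sign \<tau>" by (simp add: sign_compose sign_inverse)
      then show ?thesis using sign_idempotent[of \<tau>] by (simp add: algebra_simps)
    qed
    have "wedge d vs (permute_list \<tau> xs) = (\<Sum>\<sigma> | \<sigma> permutes {..<?n}.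
        of_int (sign \<tau>) * (of_int (sign (\<sigma> \<circ> Hilbert_Choice.inv \<tau>)) *
          (\<Prod>i<?n. vs ! (\<sigma> \<circ> Hilbert_Choice.inv \<tau>) i $ (xs ! i))))"
      unfolding wedge_def using permute_list_tensor_index[OF \<tau> xs]
      by (simp only: if_True, intro sum.cong) (auto simp: pr[unfolded o_def] sg o_def)
    also have "\<dots> = of_int (sign \<tau>) * wedge d vs xs"
      unfolding wedge_def sum_distrib_left[symmetric]
      using xs sum_permutations_compose_right[OF inv,
        of "\<lambda>\<sigma>. of_int (sign \<sigma>) * (\<Prod>i<?n. vs ! \<sigma> i $ (xs ! i))"]
      by (simp add: o_def)
    finally show ?thesis .
  qed
  then show ?thesis by (auto simp: ext_space_def wedge_def)
qed

lemma prod_sum_tensor_index: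
  fixes f :: "nat \<Rightarrow> nat \<Rightarrow> 'a :: comm_semiring_1"
  shows "(\<Prod>i<n. \<Sum>k<d. f i k) = (\<Sum>ys \<in> tensor_index d n. \<Prod>i<n. f i (ys ! i))"
proof (induction n arbitrary: f)
  case 0
  have "tensor_index d 0 = {[]}" by (auto simp: tensor_index_def)
  then show ?case by simp
next
  case (Suc n)
  have img: "tensor_index d (Suc n) = (\<lambda>(k, ys). k # ys) ` ({..<d} \<times> tensor_index d n)"
    by (auto simp: tensor_index_def length_Suc_conv image_iff)
  have inj: "inj_on (\<lambda>(k, ys). k # ys) ({..<d} \<times> tensor_index d n)"
    by (auto simp: inj_on_def)
  have "(\<Prod>i<Suc n. \<Sum>k<d. f i k) =
      (\<Sum>k<d. f 0 k) * (\<Sum>ys \<in> tensor_index d n. \<Prod>i<n. f (Suc i) (ys ! i))"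
    using Suc[of "\<lambda>i. f (Suc i)"] by (simp only: prod.lessThan_Suc_shift)
  also have "\<dots> = (\<Sum>(k, ys) \<in> {..<d} \<times> tensor_index d n. \<Prod>i<Suc n. f i ((k # ys) ! i))"
    by (simp add: sum_product sum.cartesian_product prod.lessThan_Suc_shift del: prod.lessThan_Suc)
  also have "\<dots> = (\<Sum>ys \<in> tensor_index d (Suc n). \<Prod>i<Suc n. f i (ys ! i))"
    unfolding img sum.reindex[OF inj] by (intro sum.cong) auto
  finally show ?case .
qed

lemma ext_map_wedge:
  assumes m: "m \<in> carrier_mat d e" and vs: "set vs \<subseteq> carrier_vec e"
  shows "ext_map (length vs) m (wedge e vs) = wedge d (map (\<lambda>v. m *\<^sub>v v) vs)"
proof
  fix xs
  let ?n = "length vs"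
  show "ext_map ?n m (wedge e vs) xs = wedge d (map (\<lambda>v. m *\<^sub>v v) vs) xs"
  proof (cases "xs \<in> tensor_index d ?n")
    case xs: True
    have entry: "(map (\<lambda>v. m *\<^sub>v v) vs ! \<sigma> i) $ (xs ! i) =
        (\<Sum>k<e. m $$ (xs ! i, k) * vs ! \<sigma> i $ k)"
      if "\<sigma> permutes {..<?n}" "i < ?n" for \<sigma> i
    proof -
      have "\<sigma> i < ?n" using permutes_in_image[OF that(1), of i] that(2) by simp
      moreover from this have "dim_vec (vs ! \<sigma> i) = e"
        using vs by (meson carrier_vecD nth_mem subsetD)
      moreover have "xs ! i < d" using xs that(2) by (auto simp: tensor_index_def subset_iff)
      ultimately show ?thesis
        using m by (simp add: scalar_prod_def atLeast0LessThan)
    qed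
    have "wedge d (map (\<lambda>v. m *\<^sub>v v) vs) xs = (\<Sum>\<sigma> | \<sigma> permutes {..<?n}.
        of_int (sign \<sigma>) * (\<Prod>i<?n. \<Sum>k<e. m $$ (xs ! i, k) * vs ! \<sigma> i $ k))"
      using xs by (auto simp: wedge_def entry[simplified] intro!: sum.cong prod.cong)
    also have "\<dots> = (\<Sum>\<sigma> | \<sigma> permutes {..<?n}. \<Sum>ys \<in> tensor_index e ?n.
        (\<Prod>i<?n. m $$ (xs ! i, ys ! i)) *
          (of_int (sign \<sigma>) * (\<Prod>i<?n. vs ! \<sigma> i $ (ys ! i))))"
      by (simp add: prod_sum_tensor_index prod.distrib sum_distrib_left mult_ac)
    also have "\<dots> = (\<Sum>ys \<in> tensor_index e ?n.
        (\<Prod>i<?n. m $$ (xs ! i, ys ! i)) * wedge e vs ys)"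
      by (subst sum.swap) (auto simp: wedge_def sum_distrib_left intro!: sum.cong)
    also have "\<dots> = ext_map ?n m (wedge e vs) xs"
      using m xs by (simp add: ext_map_def)
    finally show ?thesis ..
  qed (use m in \<open>simp add: ext_map_def wedge_def\<close>)
qed

lemma subspace_ext_space: "tensor.subspace (ext_space d n)"
  by (rule tensor.subspaceI) (auto simp: ext_space_def tensor_scale_def algebra_simps)

lemma span_wedge:
  "tensor.span {wedge d vs | vs. length vs = n \<and> set vs \<subseteq> carrier_vec d} = ext_space d n"
    (is "tensor.span ?W = _")
proof (rule tensor.span_unique)
  show "?W \<subseteq> ext_space d n" using wedge_in_ext_space by auto
  show "tensor.subspace (ext_space d n)" by (rule subspace_ext_space)
  fix V assume W: "?W \<subseteq> V" and V: "tensor.subspace V"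
  let ?e = "\<lambda>ys. wedge d (map (unit_vec d) ys)"
  show "ext_space d n \<subseteq> V"
  proof
    fix T assume T: "T \<in> ext_space d n"
    let ?S = "\<Sum>ys \<in> tensor_index d n. tensor_scale (T ys / fact n) (?e ys)"
    have apply_sum: "(\<Sum>i\<in>I. h i) xs = (\<Sum>i\<in>I. h i xs)" if "finite I"
      for h :: "nat list \<Rightarrow> tensor" and I xs
      using that by (induction I rule: finite_induct) auto
    have "?S xs = T xs" for xs
    proof (cases "xs \<in> tensor_index d n")
      case xs: True
      have eq: "(\<Prod>i<n. map (unit_vec d) ys ! \<sigma> i $ (xs ! i)) =
          (if ys = permute_list (Hilbert_Choice.inv \<sigma>) xs then 1 else (0 :: complex))"
        if ys: "ys \<in> tensor_index d n" and \<sigma>: "\<sigma> permutes {..<n}" for ys \<sigma>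
      proof -
        have len: "length xs = n" "length ys = n"
          using xs ys by (auto simp: tensor_index_def)
        have lt: "\<sigma> i < n" if "i < n" for i using permutes_in_image[OF \<sigma>, of i] that by simp
        have lt': "Hilbert_Choice.inv \<sigma> i < n" if "i < n" for i
          using permutes_in_image[OF permutes_inv[OF \<sigma>], of i] that by simp
        have "ys = permute_list (Hilbert_Choice.inv \<sigma>) xs \<longleftrightarrow> (\<forall>i<n. ys ! i = xs ! Hilbert_Choice.inv \<sigma> i)"
          using len permutes_inv[OF \<sigma>] by (auto simp: list_eq_iff_nth_eq permute_list_nth)
        also have "\<dots> \<longleftrightarrow> (\<forall>i<n. xs ! i = ys ! \<sigma> i)"
          using lt lt' permutes_inverses[OF \<sigma>] by metis
        finally have iff: "ys = permute_list (Hilbert_Choice.inv \<sigma>) xs \<longleftrightarrow> (\<forall>i<n. xs ! i = ys ! \<sigma> i)" .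
        have "map (unit_vec d) ys ! \<sigma> i $ (xs ! i) = (if xs ! i = ys ! \<sigma> i then 1 else 0 :: complex)"
          if "i < n" for i
        proof -
          have "xs ! i < d" "ys ! \<sigma> i < d"
            using xs ys that lt[OF that] by (auto simp: tensor_index_def subset_iff)
          then show ?thesis using lt[OF that] len by simp
        qed
        then have "(\<Prod>i<n. map (unit_vec d) ys ! \<sigma> i $ (xs ! i)) =
            (\<Prod>i<n. if xs ! i = ys ! \<sigma> i then 1 else (0 :: complex))"
          by (intro prod.cong) auto
        also have "\<dots> = (if \<forall>i<n. xs ! i = ys ! \<sigma> i then 1 else 0)"
          by (auto intro: prod_zero)
        finally show ?thesis using iff by simp
      qed
      have "?S xs = (\<Sum>ys \<in> tensor_index d n. \<Sum>\<sigma> | \<sigma> permutes {..<n}.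
          if ys = permute_list (Hilbert_Choice.inv \<sigma>) xs then T ys / fact n * of_int (sign \<sigma>) else 0)"
        unfolding apply_sum[OF finite_tensor_index]
      proof (rule sum.cong)
        fix ys assume ys: "ys \<in> tensor_index d n"
        then have len: "length ys = n" by (simp add: tensor_index_def)
        have "?e ys xs = (\<Sum>\<sigma> | \<sigma> permutes {..<n}.
            of_int (sign \<sigma>) * (\<Prod>i<n. map (unit_vec d) ys ! \<sigma> i $ (xs ! i)))"
          using xs len by (simp add: wedge_def)
        also have "\<dots> = (\<Sum>\<sigma> | \<sigma> permutes {..<n}.
            if ys = permute_list (Hilbert_Choice.inv \<sigma>) xs then of_int (sign \<sigma>) else 0)"
          using eq[OF ys] by (intro sum.cong) auto
        finally show "tensor_scale (T ys / fact n) (?e ys) xs = (\<Sum>\<sigma> | \<sigma> permutes {..<n}.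
          if ys = permute_list (Hilbert_Choice.inv \<sigma>) xs then T ys / fact n * of_int (sign \<sigma>) else 0)"
          by (auto simp: tensor_scale_def sum_distrib_left sum_divide_distrib intro!: sum.cong)
      qed simp
      also have "\<dots> = (\<Sum>\<sigma> | \<sigma> permutes {..<n}.
          T (permute_list (Hilbert_Choice.inv \<sigma>) xs) / fact n * of_int (sign \<sigma>))"
        using permute_list_tensor_index[OF permutes_inv xs]
        by (subst sum.swap) (auto simp: sum.delta intro!: sum.cong)
      also have "\<dots> = (\<Sum>\<sigma> | \<sigma> permutes {..<n}. T xs / fact n)"
      proof (rule sum.cong)
        fix \<sigma> assume "\<sigma> \<in> {\<sigma>. \<sigma> permutes {..<n}}"
        then have \<sigma>: "\<sigma> permutes {..<n}" by simp
        then have "permutation \<sigma>" using permutation_permutes by blast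
        then have "sign (Hilbert_Choice.inv \<sigma>) = sign \<sigma>" by (rule sign_inverse)
        moreover have "T (permute_list (Hilbert_Choice.inv \<sigma>) xs) = of_int (sign (Hilbert_Choice.inv \<sigma>)) * T xs"
          using T xs permutes_inv[OF \<sigma>] by (auto simp: ext_space_def)
        moreover have "of_int (sign \<sigma>) * of_int (sign \<sigma>) = (1 :: complex)"
          by (simp add: sign_def)
        ultimately show "T (permute_list (Hilbert_Choice.inv \<sigma>) xs) / fact n * of_int (sign \<sigma>) = T xs / fact n"
          by simp
      qed simp
      also have "\<dots> = T xs"
        using card_permutations[of "{..<n}" n] by simp
      finally show ?thesis .
    next
      case False
      then have "?e ys xs = 0" if "ys \<in> tensor_index d n" for ys
        using that by (auto simp: wedge_def tensor_index_def)
      then show ?thesis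
        using T False by (simp add: apply_sum ext_space_def tensor_scale_def)
    qed
    then have "T = ?S" by auto
    also have "?S \<in> V"
    proof (intro tensor.subspace_sum[OF V] tensor.subspace_scale[OF V])
      fix ys assume "ys \<in> tensor_index d n"
      then have "?e ys \<in> ?W"
        by (intro CollectI exI[of _ "map (unit_vec d) ys"]) (auto simp: tensor_index_def)
      then show "?e ys \<in> V" using W by blast
    qed
    finally show "T \<in> V" .
  qed
qed

end

theory Submission
  imports Defs "HOL-Computational_Algebra.Polynomial"
begin

text \<open>
  If \<open>m = u D u\<^sup>-\<^sup>1\<close> with \<open>D\<close> diagonal, the images under \<open>\<and>\<^sup>n u\<close> of the standard basis of the exterior
  power form an eigenbasis of \<open>\<and>\<^sup>n m\<close>, so the trace is the \<open>n\<close>-th elementary symmetric polynomial of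
  the eigenvalues, that is, the coefficient of \<open>x\<^sup>n\<close> in \<open>\<Prod>(1 + f\<^sub>i x)\<close>. Pairing conjugate eigenvalues turns
  this product into \<open>\<Prod>\<^sub>j ((1 + x\<^sup>2) + t\<^sub>j x) = \<Sum>\<^sub>k s\<^sub>k(t) x\<^sup>k (1 + x\<^sup>2)\<^sup>g\<^sup>-\<^sup>k\<close>.
\<close>

section \<open>Trace of a diagonalizable endomorphism\<close>

context vector_space
begin

text \<open>\<open>trace_on\<close> picks its basis by choice. The eigenbasis shows that some basis
  exists, so the choice is a genuine basis, and \<open>trace_basis_independent\<close> then allows
  the sum to be computed in the eigenbasis instead.\<close>

lemma trace_on_eigenbasis:
  assumes I: "finite I" and inj: "inj_on b I"
    and indep: "independent (b ` I)" and sp: "span (b ` I) = V"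
    and add: "\<And>x y. x \<in> V \<Longrightarrow> y \<in> V \<Longrightarrow> f (x + y) = f x + f y"
    and scale: "\<And>a x. x \<in> V \<Longrightarrow> f (scale a x) = scale a (f x)"
    and maps: "\<And>x. x \<in> V \<Longrightarrow> f x \<in> V"
    and eig: "\<And>i. i \<in> I \<Longrightarrow> f (b i) = scale (c i) (b i)"
  shows "trace_on V f = (\<Sum>i\<in>I. c i)"
proof -
  define B where "B = (SOME B. independent B \<and> span B = V)"
  have B: "independent B \<and> span B = V"
    unfolding B_def by (rule someI[of _ "b ` I"]) (use indep sp in simp)
  \<comment> \<open>The chosen basis is an independent set inside the span of the finite
    eigenbasis.\<close>
  have "finite B"
    using independent_span_bound[of "b ` I" B] I B sp span_superset[of B] by auto
  then have "trace_on V f = (\<Sum>x\<in>b ` I. representation (b ` I) (f x) x)"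
    unfolding trace_on_def Let_def B_def[symmetric] using B I indep sp add scale maps
    by (intro trace_basis_independent) auto
  also have "\<dots> = (\<Sum>i\<in>I. representation (b ` I) (scale (c i) (b i)) (b i))"
    by (simp add: sum.reindex[OF inj] eig)
  also have "\<dots> = (\<Sum>i\<in>I. c i)"
    by (intro sum.cong refl)
      (simp add: representation_scale indep span_base representation_basis)
  finally show ?thesis .
qed

end


section \<open>Alternating tensors and functoriality of the exterior power\<close>

text \<open>Sorting a list with distinct entries changes the value only by a sign. A list with a
  repeated entry is fixed by a transposition, so the value there equals its own negative and
  vanishes.\<close>

lemma ext_space_eqI:
  assumes T: "T \<in> ext_space d n" and U: "U \<in> ext_space d n"
    and eq: "\<And>A. A \<subseteq> {..<d} \<Longrightarrow> card A = n \<Longrightarrow>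
      T (sorted_list_of_set A) = U (sorted_list_of_set A)"
  shows "T = U"
proof
  fix xs
  have alt: "W (permute_list \<sigma> ys) = of_int (sign \<sigma>) * W ys"
    if "W \<in> ext_space d n" "\<sigma> permutes {..<n}" "ys \<in> tensor_index d n" for W \<sigma> ys
    using that by (auto simp: ext_space_def)
  show "T xs = U xs"
  proof (cases "xs \<in> tensor_index d n")
    case xs: True
    then have len: "length xs = n" and sub: "set xs \<subseteq> {..<d}"
      by (auto simp: tensor_index_def)
    show ?thesis
    proof (cases "distinct xs")
      case True
      let ?ys = "sorted_list_of_set (set xs)"
      have card: "card (set xs) = n" using True len distinct_card by blast
      have "mset xs = mset ?ys"
        using True by (intro set_eq_iff_mset_eq_distinct[THEN iffD1]) auto
      then obtain \<sigma> where "\<sigma> permutes {..<length ?ys}" "permute_list \<sigma> ?ys = xs"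
        by (rule mset_eq_permutation)
      moreover have "?ys \<in> tensor_index d n"
        using sub card by (auto simp: tensor_index_def)
      ultimately show ?thesis
        using alt[OF T, of \<sigma> ?ys] alt[OF U, of \<sigma> ?ys] eq[OF sub card] card by simp
    next
      case False
      then obtain i j where ij: "i < n" "j < n" "i \<noteq> j" "xs ! i = xs ! j"
        using len by (auto simp: distinct_conv_nth)
      let ?\<sigma> = "transpose i j"
      have \<sigma>: "?\<sigma> permutes {..<n}" using ij by (intro permutes_swap_id) auto
      have "permute_list ?\<sigma> xs = xs"
        using ij len \<sigma> by (intro nth_equalityI) (auto simp: permute_list_nth transpose_def)
      then have "W xs = - W xs" if "W \<in> ext_space d n" for W
        using alt[OF that \<sigma> xs] ij by (simp add: sign_swap_id)
      then have "W xs = 0" if "W \<in> ext_space d n" for W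
        using that by (metis eq_neg_iff_add_eq_0 mult_2 mult_eq_0_iff zero_neq_numeral)
      from this[OF T] this[OF U] show ?thesis by simp
    qed
  qed (use T U in \<open>simp add: ext_space_def\<close>)
qed

text \<open>Permuting the row list and the column list simultaneously only reorders the factors of
  the product of matrix entries. Reindexing the sum over column lists by
  \<open>permute_list \<sigma>\<close> therefore moves the permutation onto \<open>T\<close>, which
  contributes the sign.\<close>

lemma ext_map_in_ext_space:
  assumes m: "m \<in> carrier_mat d e" and T: "T \<in> ext_space e n"
  shows "ext_map n m T \<in> ext_space d n"
proof -
  have "ext_map n m T (permute_list \<sigma> xs) = of_int (sign \<sigma>) * ext_map n m T xs"
    if \<sigma>: "\<sigma> permutes {..<n}" and xs: "xs \<in> tensor_index d n" for \<sigma> xs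
  proof -
    have len: "length ys = n" if "ys \<in> tensor_index k n" for ys k
      using that by (simp add: tensor_index_def)
    have inv: "Hilbert_Choice.inv \<sigma> permutes {..<n}" using \<sigma> by (rule permutes_inv)
    have bij: "bij_betw (permute_list \<sigma>) (tensor_index e n) (tensor_index e n)"
    proof (rule bij_betw_byWitness[where f' = "permute_list (Hilbert_Choice.inv \<sigma>)"])
      show "\<forall>a\<in>tensor_index e n. permute_list (Hilbert_Choice.inv \<sigma>) (permute_list \<sigma> a) = a"
        using inv \<sigma> len by (metis permute_list_compose permutes_inv_o(1) permute_list_id)
      show "\<forall>a\<in>tensor_index e n. permute_list \<sigma> (permute_list (Hilbert_Choice.inv \<sigma>) a) = a"
        using inv \<sigma> len by (metis permute_list_compose permutes_inv_o(2) permute_list_id)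
    qed (use \<sigma> inv permute_list_tensor_index in blast)+
    have pr: "(\<Prod>i<n. m $$ (permute_list \<sigma> xs ! i, permute_list \<sigma> ys ! i)) =
        (\<Prod>i<n. m $$ (xs ! i, ys ! i))" if "ys \<in> tensor_index e n" for ys
      using prod.permute[OF \<sigma>, of "\<lambda>i. m $$ (xs ! i, ys ! i)"] \<sigma> len[OF xs] len[OF that]
      by (simp add: permute_list_nth o_def)
    have "ext_map n m T (permute_list \<sigma> xs) = (\<Sum>ys \<in> tensor_index e n.
        (\<Prod>i<n. m $$ (permute_list \<sigma> xs ! i, ys ! i)) * T ys)"
      using m permute_list_tensor_index[OF \<sigma> xs] by (simp add: ext_map_def)
    also have "\<dots> = (\<Sum>ys \<in> tensor_index e n.
        (\<Prod>i<n. m $$ (permute_list \<sigma> xs ! i, permute_list \<sigma> ys ! i)) * T (permute_list \<sigma> ys))"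
      by (rule sum.reindex_bij_betw[OF bij, symmetric])
    also have "\<dots> = (\<Sum>ys \<in> tensor_index e n.
        of_int (sign \<sigma>) * ((\<Prod>i<n. m $$ (xs ! i, ys ! i)) * T ys))"
      using T \<sigma> by (intro sum.cong refl) (auto simp: pr ext_space_def)
    also have "\<dots> = of_int (sign \<sigma>) * ext_map n m T xs"
      using m xs by (simp add: ext_map_def sum_distrib_left)
    finally show ?thesis .
  qed
  then show ?thesis using m by (auto simp: ext_space_def ext_map_def)
qed

lemma linear_ext_map: "Vector_Spaces.linear tensor_scale tensor_scale (ext_map n m)"
  by unfold_locales
    (auto simp: ext_map_def tensor_scale_def fun_eq_iff algebra_simps sum.distrib sum_distrib_left)

text \<open>Expanding a product of matrix product entries by distributivity gives a sum over
  intermediate index lists \<open>ys\<close>; exchanging the two sums gives the composition. The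
  argument does not involve alternation, so \<open>T\<close> is arbitrary.\<close>

lemma ext_map_mult:
  assumes a: "a \<in> carrier_mat d e" and b: "b \<in> carrier_mat e f"
  shows "ext_map n (a * b) T = ext_map n a (ext_map n b T)"
proof
  fix xs
  show "ext_map n (a * b) T xs = ext_map n a (ext_map n b T) xs"
  proof (cases "xs \<in> tensor_index d n")
    case xs: True
    have "(\<Prod>i<n. (a * b) $$ (xs ! i, zs ! i)) =
        (\<Sum>ys \<in> tensor_index e n. (\<Prod>i<n. a $$ (xs ! i, ys ! i)) * (\<Prod>i<n. b $$ (ys ! i, zs ! i)))"
      if zs: "zs \<in> tensor_index f n" for zs
    proof -
      have "(a * b) $$ (xs ! i, zs ! i) = (\<Sum>k<e. a $$ (xs ! i, k) * b $$ (k, zs ! i))"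
        if "i < n" for i
      proof -
        have "xs ! i < d" "zs ! i < f"
          using xs zs that by (auto simp: tensor_index_def subset_iff)
        then show ?thesis using a b by (simp add: scalar_prod_def atLeast0LessThan)
      qed
      then show ?thesis by (simp add: prod_sum_tensor_index prod.distrib)
    qed
    then have "ext_map n (a * b) T xs = (\<Sum>zs \<in> tensor_index f n. \<Sum>ys \<in> tensor_index e n.
        (\<Prod>i<n. a $$ (xs ! i, ys ! i)) * ((\<Prod>i<n. b $$ (ys ! i, zs ! i)) * T zs))"
      using a b xs by (simp add: ext_map_def sum_distrib_right mult.assoc)
    also have "\<dots> = ext_map n a (ext_map n b T) xs"
      using a b xs by (subst sum.swap) (simp add: ext_map_def sum_distrib_left)
    finally show ?thesis .
  qed (use a in \<open>simp add: ext_map_def\<close>)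
qed

lemma ext_map_mat_diag:
  assumes "xs \<in> tensor_index d n"
  shows "ext_map n (mat_diag d f) T xs = (\<Prod>i<n. f (xs ! i)) * T xs"
proof -
  have lt: "ys ! i < d" if "ys \<in> tensor_index d n" "i < n" for ys i
    using that by (auto simp: tensor_index_def subset_iff)
  have "(\<Prod>i<n. mat_diag d f $$ (xs ! i, ys ! i)) = (if ys = xs then \<Prod>i<n. f (xs ! i) else 0)"
    if ys: "ys \<in> tensor_index d n" for ys
  proof (cases "ys = xs")
    \<comment> \<open>Two different lists disagree at some position, where the diagonal matrix
      contributes a zero factor.\<close>
    case False
    then obtain i where "i < n" "xs ! i \<noteq> ys ! i"
      using assms ys by (auto simp: tensor_index_def list_eq_iff_nth_eq)
    then show ?thesis using False lt assms ys
      by (auto simp: mat_diag_def intro!: prod_zero bexI[of _ i])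
  qed (use lt[OF assms] in \<open>simp add: mat_diag_def\<close>)
  moreover have "dim_row (mat_diag d f) = d" "dim_col (mat_diag d f) = d"
    by (simp_all add: mat_diag_def)
  ultimately show ?thesis using assms
    by (simp add: ext_map_def if_distrib[of "\<lambda>c. c * _"] sum.delta' cong: if_cong)
qed

text \<open>\<open>ext_map\<close> returns 0 outside the index lists, so the identity matrix can
  only fix tensors that vanish there; membership in \<open>ext_space\<close> supplies this.\<close>

lemma ext_map_one:
  assumes "T \<in> ext_space d n"
  shows "ext_map n (1\<^sub>m d) T = T"
proof
  fix xs
  have "1\<^sub>m d = mat_diag d (\<lambda>_. 1 :: complex)" by (auto simp: mat_diag_def)
  then show "ext_map n (1\<^sub>m d) T xs = T xs"
    using assms ext_map_mat_diag[of xs d n "\<lambda>_. 1" T]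
    by (cases "xs \<in> tensor_index d n") (auto simp: ext_space_def ext_map_def)
qed

section \<open>The standard basis of the exterior power\<close>

text \<open>Listing the subset in increasing order fixes the sign of the wedge product.\<close>

definition wedge_unit :: "nat \<Rightarrow> nat set \<Rightarrow> tensor" where
  "wedge_unit d A = wedge d (map (unit_vec d) (sorted_list_of_set A))"

lemma wedge_unit_in_ext_space: "card A = n \<Longrightarrow> wedge_unit d A \<in> ext_space d n"
  using wedge_in_ext_space[of d "map (unit_vec d) (sorted_list_of_set A)"]
  by (simp add: wedge_unit_def)

text \<open>Evaluations at increasing lists are the dual basis. A permutation contributes only if it
  carries one increasing list to the other, which forces the two sets to be equal and the
  permutation to be the identity.\<close>

lemma wedge_unit_sorted_list_of_set:
  assumes A: "A \<subseteq> {..<d}" "card A = n" and B: "B \<subseteq> {..<d}" "card B = n"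
  shows "wedge_unit d A (sorted_list_of_set B) = (if A = B then 1 else 0)"
proof -
  let ?a = "sorted_list_of_set A" and ?b = "sorted_list_of_set B"
  have fin: "finite A" "finite B" using A B finite_subset by blast+
  have len: "length ?a = n" "length ?b = n" using A B by simp_all
  have lt: "\<sigma> i < n" if "\<sigma> permutes {..<n}" "i < n" for \<sigma> i
    using permutes_in_image[OF that(1), of i] that(2) by simp
  have entry: "map (unit_vec d) ?a ! \<sigma> i $ (?b ! i) = (if ?b ! i = ?a ! \<sigma> i then 1 else 0 :: complex)"
    if "\<sigma> permutes {..<n}" "i < n" for \<sigma> i
  proof -
    have "?b ! i \<in> B" "?a ! \<sigma> i \<in> A"
      using fin len that lt nth_mem[of i ?b] nth_mem[of "\<sigma> i" ?a] by auto
    then have "?b ! i < d" "?a ! \<sigma> i < d" using A B by auto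
    then show ?thesis using lt[OF that] len by simp
  qed
  have pr: "(\<Prod>i<n. map (unit_vec d) ?a ! \<sigma> i $ (?b ! i)) = (if A = B \<and> \<sigma> = id then 1 else 0 :: complex)"
    if \<sigma>: "\<sigma> permutes {..<n}" for \<sigma>
  proof -
    have "(\<Prod>i<n. map (unit_vec d) ?a ! \<sigma> i $ (?b ! i)) =
        (\<Prod>i<n. if ?b ! i = ?a ! \<sigma> i then 1 else 0 :: complex)"
      using entry[OF \<sigma>] by (intro prod.cong) auto
    also have "\<dots> = (if \<forall>i<n. ?b ! i = ?a ! \<sigma> i then 1 else 0)"
      by (auto intro: prod_zero)
    also have "(\<forall>i<n. ?b ! i = ?a ! \<sigma> i) \<longleftrightarrow> A = B \<and> \<sigma> = id"
    proof
      assume *: "\<forall>i<n. ?b ! i = ?a ! \<sigma> i"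
      then have "?b = permute_list \<sigma> ?a"
        using \<sigma> len by (auto simp: list_eq_iff_nth_eq permute_list_nth)
      then have "set ?b = set ?a" using \<sigma> len by simp
      then have AB: "A = B" using fin by simp
      \<comment> \<open>Below \<open>n\<close> this is distinctness of the sorted list; from
        \<open>n\<close> on, the permutation fixes every index by definition.\<close>
      have "\<sigma> i = i" for i
      proof (cases "i < n")
        case True
        then have "?a ! i = ?a ! \<sigma> i" using * AB by simp
        then show ?thesis using len lt[OF \<sigma> True] True nth_eq_iff_index_eq[of ?a] by auto
      qed (use \<sigma> in \<open>simp add: permutes_def\<close>)
      then show "A = B \<and> \<sigma> = id" using AB by auto
    qed auto
    finally show ?thesis .
  qed
  have "?b \<in> tensor_index d n" using B fin by (auto simp: tensor_index_def)
  then have "wedge_unit d A ?b = (\<Sum>\<sigma> | \<sigma> permutes {..<n}.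
      of_int (sign \<sigma>) * (\<Prod>i<n. map (unit_vec d) ?a ! \<sigma> i $ (?b ! i)))"
    using len unfolding wedge_unit_def wedge_def by simp
  also have "\<dots> = (\<Sum>\<sigma> | \<sigma> permutes {..<n}. if \<sigma> = id then if A = B then 1 else 0 else 0)"
    by (intro sum.cong refl) (simp add: pr id_def)
  also have "\<dots> = (if A = B then 1 else 0)"
    by (simp add: sum.delta' finite_permutations permutes_id)
  finally show ?thesis .
qed

lemma sum_tensor_apply:
  fixes h :: "'i \<Rightarrow> tensor"
  shows "(\<Sum>i\<in>I. h i) xs = (\<Sum>i\<in>I. h i xs)"
  by (induction I rule: infinite_finite_induct) auto

lemma wedge_unit_basis:
  defines "I \<equiv> \<lambda>d n. {A. A \<subseteq> {..<d} \<and> card A = n}"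
  shows "inj_on (wedge_unit d) (I d n)"
    and "tensor.independent (wedge_unit d ` I d n)"
    and "tensor.span (wedge_unit d ` I d n) = ext_space d n"
proof -
  have fin: "finite (I d n)" by (simp add: I_def)
  have dual: "wedge_unit d A (sorted_list_of_set B) = (if A = B then 1 else 0)"
    if "A \<in> I d n" "B \<in> I d n" for A B
    using that wedge_unit_sorted_list_of_set by (auto simp: I_def)
  show inj: "inj_on (wedge_unit d) (I d n)"
    by (rule inj_onI) (metis dual zero_neq_one)
  \<comment> \<open>By duality, evaluation at an increasing list reads off one coefficient of a
    linear combination. This gives independence here and the expansion of an arbitrary alternating
    tensor below.\<close>
  have coord: "(\<Sum>A\<in>I d n. tensor_scale (c A) (wedge_unit d A)) (sorted_list_of_set B) = c B"
    if B: "B \<in> I d n" for c B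
    using fin B by (simp add: sum_tensor_apply tensor_scale_def dual if_distrib[of "\<lambda>x. _ * x"]
        sum.delta' cong: if_cong)
  show "tensor.independent (wedge_unit d ` I d n)"
  proof (rule tensor.independent_if_scalars_zero)
    fix f x
    assume "(\<Sum>x\<in>wedge_unit d ` I d n. tensor_scale (f x) x) = 0" and x: "x \<in> wedge_unit d ` I d n"
    then have "(\<Sum>A\<in>I d n. tensor_scale (f (wedge_unit d A)) (wedge_unit d A)) = 0"
      by (simp add: sum.reindex[OF inj])
    then show "f x = 0" using coord[of _ "\<lambda>A. f (wedge_unit d A)"] x by auto
  qed (simp add: fin)
  show "tensor.span (wedge_unit d ` I d n) = ext_space d n"
  proof (rule tensor.span_unique)
    show "wedge_unit d ` I d n \<subseteq> ext_space d n"
      using wedge_unit_in_ext_space by (auto simp: I_def)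
    show "tensor.subspace (ext_space d n)" by (rule subspace_ext_space)
    fix V assume W: "wedge_unit d ` I d n \<subseteq> V" and V: "tensor.subspace V"
    show "ext_space d n \<subseteq> V"
    proof
      fix T assume T: "T \<in> ext_space d n"
      let ?S = "\<Sum>A\<in>I d n. tensor_scale (T (sorted_list_of_set A)) (wedge_unit d A)"
      have "T = ?S"
      proof (rule ext_space_eqI[OF T])
        show "?S \<in> ext_space d n"
          using wedge_unit_in_ext_space
          by (intro tensor.subspace_sum tensor.subspace_scale subspace_ext_space) (auto simp: I_def)
      qed (simp add: coord[unfolded I_def] I_def)
      also have "?S \<in> V"
        using W by (intro tensor.subspace_sum[OF V] tensor.subspace_scale[OF V]) auto
      finally show "T \<in> V" .
    qed
  qed
qed

section \<open>The trace as an elementary symmetric polynomial of the eigenvalues\<close>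

lemma trace_ext_map_diagonalizable:
  assumes "m \<in> carrier_mat d d" and sim: "similar_mat_wit m (mat_diag d f) u v"
  shows "tensor.trace_on (ext_space d n) (ext_map n m) =
    (\<Sum>A | A \<subseteq> {..<d} \<and> card A = n. \<Prod>i\<in>A. f i)"
proof -
  interpret pair: vector_space_pair tensor_scale tensor_scale by unfold_locales
  let ?I = "{A. A \<subseteq> {..<d} \<and> card A = n}" and ?D = "mat_diag d f"
  let ?b = "\<lambda>A. ext_map n u (wedge_unit d A)"
  have u: "u \<in> carrier_mat d d" and v: "v \<in> carrier_mat d d" and D: "?D \<in> carrier_mat d d"
    and uv: "u * v = 1\<^sub>m d" and vu: "v * u = 1\<^sub>m d" and m_eq: "m = u * ?D * v"
    using similar_mat_witD2[OF assms] by blast+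
  have mu: "m * u = u * ?D"
    using u v D vu assoc_mult_mat[of "u * ?D" d d v d u d] right_mult_one_mat[of "u * ?D" d d]
    by (simp add: m_eq)
  have vu_T: "ext_map n v (ext_map n u T) = T" and uv_T: "ext_map n u (ext_map n v T) = T"
    if "T \<in> ext_space d n" for T
    using that ext_map_mult[OF u v, of n T] ext_map_mult[OF v u, of n T] ext_map_one[OF that]
    by (simp_all add: uv vu)
  note lin = linear_ext_map[of n u]
  note basis = wedge_unit_basis[of d n]
  \<comment> \<open>Injectivity is restricted to the exterior power, the span of the basis: on all
    tensors \<open>ext_map\<close> kills those supported outside the index lists.\<close>
  have inj_u: "inj_on (ext_map n u) (ext_space d n)"
    by (rule inj_on_inverseI) (rule vu_T)
  have sub: "wedge_unit d ` ?I \<subseteq> ext_space d n"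
    using wedge_unit_in_ext_space by auto
  have img: "?b ` ?I = ext_map n u ` wedge_unit d ` ?I" by (simp add: image_image)
  have surj_u: "ext_map n u ` ext_space d n = ext_space d n"
    using ext_map_in_ext_space[OF u] ext_map_in_ext_space[OF v] uv_T by (force simp: image_iff)
  show ?thesis
  proof (rule tensor.trace_on_eigenbasis[where b = ?b])
    show "inj_on ?b ?I"
      using comp_inj_on[OF basis(1) inj_on_subset[OF inj_u sub]] by (simp add: o_def)
    show "tensor.independent (?b ` ?I)" unfolding img
      using basis inj_u
      by (intro pair.linear_independent_injective_image[OF lin]) auto
    show "tensor.span (?b ` ?I) = ext_space d n" unfolding img
      using pair.linear_span_image[OF lin] basis(3) surj_u by simp
    show "ext_map n m (x + y) = ext_map n m x + ext_map n m y" for x y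
      by (rule pair.linear_add[OF linear_ext_map])
    show "ext_map n m (tensor_scale a x) = tensor_scale a (ext_map n m x)" for a x
      by (rule pair.linear_scale[OF linear_ext_map])
    show "ext_map n m x \<in> ext_space d n" if "x \<in> ext_space d n" for x
      using ext_map_in_ext_space assms(1) that by blast
    fix A assume A: "A \<in> ?I"
    then have e: "wedge_unit d A \<in> ext_space d n" using wedge_unit_in_ext_space by auto
    \<comment> \<open>At the increasing list of \<open>B\<close> the diagonal matrix multiplies by
      the product over \<open>B\<close>, not over \<open>A\<close>; the two sides still agree
      because the basis vector vanishes there unless \<open>A = B\<close>.\<close>
    have "ext_map n ?D (wedge_unit d A) = tensor_scale (\<Prod>i\<in>A. f i) (wedge_unit d A)"
    proof (rule ext_space_eqI)
      show "ext_map n ?D (wedge_unit d A) \<in> ext_space d n"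
        using ext_map_in_ext_space[OF D e] .
      show "tensor_scale (\<Prod>i\<in>A. f i) (wedge_unit d A) \<in> ext_space d n"
        using tensor.subspace_scale[OF subspace_ext_space e] .
      fix B assume B: "B \<subseteq> {..<d}" "card B = n"
      then have fin: "finite B" using finite_subset by blast
      let ?l = "sorted_list_of_set B"
      have "?l \<in> tensor_index d n" using B fin by (simp add: tensor_index_def)
      moreover have "(\<Prod>i<n. f (?l ! i)) = (\<Prod>i\<in>B. f i)"
        using B fin prod.reindex_bij_betw[OF bij_betw_nth[of ?l "{..<n}" B], of f] by simp
      ultimately show "ext_map n ?D (wedge_unit d A) ?l =
          tensor_scale (\<Prod>i\<in>A. f i) (wedge_unit d A) ?l"
        using A B by (simp add: ext_map_mat_diag tensor_scale_def wedge_unit_sorted_list_of_set)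
    qed
    \<comment> \<open>The eigenvector equation is carried from the diagonal matrix to
      \<open>m\<close> by \<open>mu\<close>.\<close>
    then show "ext_map n m (?b A) = tensor_scale (\<Prod>i\<in>A. f i) (?b A)"
      using ext_map_mult[OF assms(1) u, of n "wedge_unit d A", symmetric]
        ext_map_mult[OF u D, of n "wedge_unit d A"] pair.linear_scale[OF lin]
      by (simp add: mu)
  qed simp
qed

section \<open>Coefficients of the generating polynomials\<close>

lemma prod_monom_Suc_0:
  "(\<Prod>i\<in>A. monom (f i) (Suc 0)) = monom (\<Prod>i\<in>A. f i) (card A)"
  by (induction A rule: infinite_finite_induct) (auto simp: mult_monom)

text \<open>Expanding the product chooses the linear term on a subset \<open>A\<close> and 1
  elsewhere, giving a monomial of degree \<open>card A\<close>.\<close>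

lemma coeff_prod_one_plus_linear:
  fixes f :: "'i \<Rightarrow> 'a :: comm_ring_1"
  assumes "finite I"
  shows "coeff (\<Prod>i\<in>I. [:1, f i:]) n = (\<Sum>A | A \<subseteq> I \<and> card A = n. \<Prod>i\<in>A. f i)"
proof -
  have "(\<Prod>i\<in>I. [:1, f i:]) = (\<Prod>i\<in>I. monom (f i) 1 + 1)"
    by (intro prod.cong) (auto simp: monom_altdef one_pCons)
  also have "\<dots> = (\<Sum>A\<in>Pow I. monom (\<Prod>i\<in>A. f i) (card A))"
    using assms by (simp add: prod_add prod_monom_Suc_0)
  finally show ?thesis using assms
    by (simp add: coeff_sum coeff_monom sum.If_cases Pow_def Collect_conj_eq[symmetric] conj_commute)
qed

lemma coeff_one_plus_square_power:
  "coeff ([:1, 0, 1:] ^ k :: 'a :: comm_ring_1 poly) l =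
    (if even l then of_nat (k choose (l div 2)) else 0)"
proof -
  have "[:1, 0, 1:] ^ k = (monom 1 2 + 1 :: 'a poly) ^ k"
    by (intro arg_cong[of _ _ "\<lambda>p. p ^ k"]) (simp add: monom_altdef numeral_2_eq_2 one_pCons)
  also have "\<dots> = (\<Sum>i\<le>k. monom (of_nat (k choose i)) (2 * i))"
    by (simp add: binomial_ring monom_power of_nat_monom mult_monom)
  finally have *: "coeff ([:1, 0, 1:] ^ k :: 'a poly) l =
      (\<Sum>i\<le>k. if 2 * i = l then of_nat (k choose i) else 0)"
    by (simp add: coeff_sum)
  show ?thesis
  proof (cases "even l")
    case True
    then have "2 * i = l \<longleftrightarrow> i = l div 2" for i by auto
    \<comment> \<open>If \<open>l div 2\<close> exceeds \<open>k\<close>, no summand matches, in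
      agreement with a vanishing binomial coefficient.\<close>
    then show ?thesis using True by (simp add: * sum.delta binomial_eq_0)
  next
    case False
    then show ?thesis unfolding * by (auto intro!: sum.neutral)
  qed
qed

text \<open>Each factor splits into its linear term and the common even part, so the expansion runs
  over the set \<open>A\<close> of factors contributing the linear term. The even part must supply
  the remaining degree \<open>n - card A\<close>, and \<open>j\<close> is half of that.\<close>

lemma coeff_prod_palindromic_quadratic:
  fixes s :: "nat \<Rightarrow> 'a :: comm_ring_1"
  assumes "n \<le> g"
  shows "coeff (\<Prod>j<g. [:1, s j, 1:]) n = (\<Sum>j = 0..n div 2. of_nat ((g + 2 * j - n) choose j) *
    (\<Sum>A | A \<subseteq> {..<g} \<and> card A = n - 2 * j. \<Prod>i\<in>A. s i))"
proof -
  let ?P = "\<lambda>A. \<Prod>i\<in>A. s i"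
  have "(\<Prod>j<g. [:1, s j, 1:]) = (\<Prod>j<g. monom (s j) 1 + [:1, 0, 1:])"
    by (intro prod.cong) (auto simp: monom_altdef one_pCons)
  also have "\<dots> = (\<Sum>A\<in>Pow {..<g}. monom (?P A) (card A) * [:1, 0, 1:] ^ (g - card A))"
    using finite_subset[of _ "{..<g}"] by (auto simp: prod_add prod_monom_Suc_0 card_Diff_subset intro!: sum.cong)
  \<comment> \<open>The guard \<open>card A \<le> n\<close> excludes monomials of too large a
    degree, for which the truncated difference \<open>n - card A\<close> would be a misleading
    0.\<close>
  finally have "coeff (\<Prod>j<g. [:1, s j, 1:]) n = (\<Sum>A\<in>Pow {..<g}.
      if card A \<le> n \<and> even (n - card A) then ?P A * of_nat ((g - card A) choose ((n - card A) div 2)) else 0)"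
    by (auto simp: coeff_sum coeff_monom_mult coeff_one_plus_square_power intro!: sum.cong)
  also have "\<dots> = (\<Sum>A | A \<subseteq> {..<g} \<and> card A \<le> n \<and> even (n - card A).
      ?P A * of_nat ((g - card A) choose ((n - card A) div 2)))"
    by (subst sum.inter_filter[symmetric]) (auto intro!: sum.cong)
  also have "\<dots> = (\<Sum>j = 0..n div 2. \<Sum>A | A \<in> {A. A \<subseteq> {..<g} \<and> card A \<le> n \<and> even (n - card A)} \<and>
      (n - card A) div 2 = j. ?P A * of_nat ((g - card A) choose ((n - card A) div 2)))"
    by (rule sum.group[symmetric]) (auto intro: div_le_mono)
  also have "\<dots> = (\<Sum>j = 0..n div 2. of_nat ((g + 2 * j - n) choose j) *
    (\<Sum>A | A \<subseteq> {..<g} \<and> card A = n - 2 * j. ?P A))"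
    unfolding sum_distrib_left
  proof (intro sum.cong refl)
    fix j assume "j \<in> {0..n div 2}"
    then have j: "2 * j \<le> n" by auto
    \<comment> \<open>Evenness matters: \<open>div\<close> alone would also put
      \<open>c = n - 2 * j - 1\<close> into the same group.\<close>
    have "c \<le> n \<and> even (n - c) \<and> (n - c) div 2 = j \<longleftrightarrow> c = n - 2 * j" for c
    proof
      assume c: "c \<le> n \<and> even (n - c) \<and> (n - c) div 2 = j"
      then have "n - c = 2 * j" by (metis dvd_mult_div_cancel)
      then show "c = n - 2 * j" using c by linarith
    next
      assume "c = n - 2 * j"
      then have "n - c = 2 * j" "c \<le> n" using j by linarith+
      then show "c \<le> n \<and> even (n - c) \<and> (n - c) div 2 = j" by simp
    qed
    then show "{A \<in> {A. A \<subseteq> {..<g} \<and> card A \<le> n \<and> even (n - card A)}. (n - card A) div 2 = j} =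
        {A. A \<subseteq> {..<g} \<and> card A = n - 2 * j}"
      by blast
    fix A assume "A \<in> {A. A \<subseteq> {..<g} \<and> card A = n - 2 * j}"
    then have "g - card A = g + 2 * j - n" "(n - card A) div 2 = j" using j assms by auto
    then show "?P A * of_nat ((g - card A) choose ((n - card A) div 2)) =
        of_nat ((g + 2 * j - n) choose j) * ?P A" by simp
  qed
  finally show ?thesis .
qed

section \<open>Pairing conjugate eigenvalues\<close>

theorem theoremA7:
  fixes g n :: nat and t :: "real vec" and m :: "complex mat"
  assumes "g \<ge> 1"
    and "t \<in> carrier_vec g"
    and "\<forall>i<g. t $ i \<in> {-2..2}"
    and "m \<in> USp g"
    and "USp_conjugate g m (kmat t)"
    and "n \<le> g"
  shows "tensor.trace_on (ext_space (2 * g) n) (ext_map n m) =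
    complex_of_real (\<Sum>j = 0..n div 2. real ((g + 2 * j - n) choose j) * elem_sym (n - 2 * j) t)"
proof -
  define \<theta> where "\<theta> j = arccos (t $ j / 2)" for j
  define f where "f i = (if i < g then exp (\<i> * complex_of_real (\<theta> i))
      else exp (- \<i> * complex_of_real (\<theta> (i - g))))" for i
  have dim: "dim_vec t = g" using assms(2) by simp
  have "kmat t = mat_diag (2 * g) f"
    unfolding kmat_def Let_def dim f_def[abs_def] \<theta>_def by simp
  then obtain u v where "similar_mat_wit m (mat_diag (2 * g) f) u v"
    using assms(5) by (auto simp: USp_conjugate_def)
  then have "tensor.trace_on (ext_space (2 * g) n) (ext_map n m) =
      coeff (\<Prod>i<2 * g. [:1, f i:]) n"
    using trace_ext_map_diagonalizable assms(4)
    by (simp add: coeff_prod_one_plus_linear USp_def)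
  \<comment> \<open>Splitting the index range at \<open>g\<close> and shifting the upper half aligns
    each eigenvalue with its inverse.\<close>
  also have "(\<Prod>i<2 * g. [:1, f i:]) = (\<Prod>j<g. [:1, f j:]) * (\<Prod>j<g. [:1, f (g + j):])"
    using prod.atLeastLessThan_concat[of 0 g "2 * g" "\<lambda>i. [:1, f i:]"]
      prod.shift_bounds_nat_ivl[of "\<lambda>i. [:1, f i:]" 0 g g]
    by (simp add: atLeast0LessThan mult_2 add.commute)
  also have "\<dots> = (\<Prod>j<g. [:1, complex_of_real (t $ j), 1:])"
    unfolding prod.distrib[symmetric]
  proof (intro prod.cong refl)
    fix j assume "j \<in> {..<g}"
    then have j: "j < g" by simp
    have "f j * f (g + j) = 1" using j by (simp add: f_def exp_minus)
    moreover have "f j + f (g + j) = complex_of_real (2 * cos (\<theta> j))"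
      using j by (simp add: f_def exp_minus complex_eq_iff flip: cis_conv_exp)
    \<comment> \<open>The bound on the entries puts \<open>t $ j / 2\<close> into the interval from
      -1 to 1, where \<open>cos\<close> inverts \<open>arccos\<close>.\<close>
    moreover have "2 * cos (\<theta> j) = t $ j" using assms(3) j by (simp add: \<theta>_def)
    ultimately show "[:1, f j:] * [:1, f (g + j):] = [:1, complex_of_real (t $ j), 1:]"
      by (simp add: add.commute mult.commute)
  qed
  finally show ?thesis
    by (simp add: coeff_prod_palindromic_quadratic[OF assms(6)] elem_sym_def dim)
qed

end
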